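(* The class $(\mathrm{M})$ of semi-boolean $\ell$-groups is a radical class.
   Context: $\ell$-group means lattice-ordered group (not necessarily abelian, written additively). For $a\in G$, $G(a)=\{b\in G:|b|\le n|a|\text{ for some }n\in\mathbb{N}\}$ is the principal convex $\ell$-subgroup generated by $a$, and for $S\subseteq G$, $S^\perp=\{h\in G:|h|\wedge|s|=0\text{ for all }s\in S\}$. $G\in(\mathrm{M})$ ($G$ is semi-boolean) means that every convex $\ell$-subgroup $H$ of $G$ satisfies $a^{\perp\perp}\subseteq H$ for all $a\in H$; equivalently $G(a)=a^{\perp\perp}$ for all $a\in G$. A class $\mathcal{R}$ of $\ell$-groups is a radical class if it is nonempty, closed under isomorphic images, closed under convex $\ell$-subgroups, and closed under joins of convex $\ell$-subgroups: whenever $G$ is an $\ell$-group and $(A_\lambda)_{\lambda\in\Lambda}$ is a family of convex $\ell$-subgroups of $G$ each belonging to $\mathcal{R}$, the join $\bigvee_{\lambda}A_\lambda$ in the lattice of convex $\ell$-subgroups of $G$ belongs to $\mathcal{R}$. *)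

theory Defs
  imports "HOL-Algebra.Algebra"
begin

text \<open>
  Lattice-ordered groups are groups in the sense of HOL-Algebra with an additional order. They are
  not assumed commutative. We keep the multiplicative notation of HOL-Algebra, so
  \<open>x \<otimes> y\<close>, \<open>\<one>\<close>, \<open>inv x\<close> stand for \<open>x + y\<close>, \<open>0\<close>, \<open>- x\<close>.
\<close>

record 'a lgroup = "'a monoid" +
  lgroup_le :: "'a \<Rightarrow> 'a \<Rightarrow> bool"

definition order_of :: "('a, 'm) lgroup_scheme \<Rightarrow> 'a gorder" where
  "order_of G = \<lparr>carrier = carrier G, eq = (=), le = lgroup_le G\<rparr>"

locale lgroup = group G + order: lattice "order_of G"
  for G :: "('a, 'm) lgroup_scheme" (structure) +
  assumes translation_mono:
    "\<lbrakk>x \<in> carrier G; y \<in> carrier G; u \<in> carrier G; v \<in> carrier G; lgroup_le G x y\<rbrakk>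
      \<Longrightarrow> lgroup_le G (u \<otimes> x \<otimes> v) (u \<otimes> y \<otimes> v)"

definition labs :: "('a, 'm) lgroup_scheme \<Rightarrow> 'a \<Rightarrow> 'a" where
  "labs G x = x \<squnion>\<^bsub>order_of G\<^esub> (inv\<^bsub>G\<^esub> x)"

definition polar :: "('a, 'm) lgroup_scheme \<Rightarrow> 'a set \<Rightarrow> 'a set" where
  "polar G S = {h \<in> carrier G. \<forall>s\<in>S. labs G h \<sqinter>\<^bsub>order_of G\<^esub> labs G s = \<one>\<^bsub>G\<^esub>}"

definition convex_lsubgroup :: "('a, 'm) lgroup_scheme \<Rightarrow> 'a set \<Rightarrow> bool" where
  "convex_lsubgroup G H \<longleftrightarrow>
     subgroup H G
   \<and> (\<forall>x\<in>H. \<forall>y\<in>H. x \<squnion>\<^bsub>order_of G\<^esub> y \<in> H \<and> x \<sqinter>\<^bsub>order_of G\<^esub> y \<in> H)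
   \<and> (\<forall>x\<in>H. \<forall>y\<in>H. \<forall>z\<in>carrier G. lgroup_le G x z \<and> lgroup_le G z y \<longrightarrow> z \<in> H)"

definition convex_lsubgroup_lattice :: "('a, 'm) lgroup_scheme \<Rightarrow> 'a set gorder" where
  "convex_lsubgroup_lattice G =
     \<lparr>carrier = {H. convex_lsubgroup G H}, eq = (=), le = (\<subseteq>)\<rparr>"

definition lgroup_iso :: "('a, 'm) lgroup_scheme \<Rightarrow> ('b, 'n) lgroup_scheme \<Rightarrow> ('a \<Rightarrow> 'b) set" where
  "lgroup_iso G K =
     {f \<in> iso G K. join_pres (order_of G) (order_of K) f \<and> meet_pres (order_of G) (order_of K) f}"

definition semi_boolean :: "'a lgroup \<Rightarrow> bool" where
  "semi_boolean G \<longleftrightarrow>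
     lgroup G \<and> (\<forall>H. convex_lsubgroup G H \<longrightarrow> (\<forall>a\<in>H. polar G (polar G {a}) \<subseteq> H))"

text \<open>
  A class of \<open>\<ell>\<close>-groups is a polymorphic predicate. A definition can only refer to a given
  predicate at one type, so closure under isomorphic images has the two instances of the predicate,
  at the types of the source and of the target, as separate arguments.
\<close>

definition closed_under_iso :: "('a lgroup \<Rightarrow> bool) \<Rightarrow> ('b lgroup \<Rightarrow> bool) \<Rightarrow> bool" where
  "closed_under_iso R R' \<longleftrightarrow>
     (\<forall>G K. R G \<and> lgroup K \<and> lgroup_iso G K \<noteq> {} \<longrightarrow> R' K)"

text \<open>
  A family of convex \<open>\<ell>\<close>-subgroups enters the join only through its range, so families are
  given as (possibly empty) sets \<open>\<A>\<close>.
\<close>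

definition radical_class :: "('a lgroup \<Rightarrow> bool) \<Rightarrow> bool" where
  "radical_class R \<longleftrightarrow>
     (\<forall>G. R G \<longrightarrow> lgroup G)
   \<and> (\<exists>G. R G)
   \<and> closed_under_iso R R
   \<and> (\<forall>G H. R G \<and> convex_lsubgroup G H \<longrightarrow> R (G\<lparr>carrier := H\<rparr>))
   \<and> (\<forall>G \<A>. lgroup G \<and> (\<forall>A\<in>\<A>. convex_lsubgroup G A \<and> R (G\<lparr>carrier := A\<rparr>))
        \<longrightarrow> R (G\<lparr>carrier := \<Squnion>\<^bsub>convex_lsubgroup_lattice G\<^esub> \<A>\<rparr>))"

end

theory Submission
  imports Defs
begin

text \<open>
  The only substantial point is closure under joins. Let \<open>J\<close> be the join of semi-boolean convex
  \<open>\<ell>\<close>-subgroups \<open>A\<close>, and let \<open>a \<in> N\<close> for a convex \<open>\<ell>\<close>-subgroup \<open>N\<close> of \<open>J\<close>. By Riesz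
  decomposition, a positive element of \<open>a\<^sup>\<bottom>\<^sup>\<bottom>\<close> is a product of positive elements of
  \<open>a\<^sup>\<bottom>\<^sup>\<bottom>\<close> each lying in some \<open>A\<close>. If \<open>y \<in> A\<close> is such a factor, then
  \<open>c = \<bar>a\<bar> \<sqinter> y\<close> lies in \<open>N \<inter> A\<close> by convexity, and \<open>y\<close> lies in \<open>c\<^sup>\<bottom>\<^sup>\<bottom>\<close> computed
  in \<open>A\<close>, since \<open>z \<sqinter> c = \<one>\<close> means that \<open>z \<sqinter> y\<close> is orthogonal to \<open>a\<close>, hence to
  \<open>y\<close>. So \<open>y \<in> N\<close>.
\<close>

lemma order_of_simps [simp]:
  "carrier (order_of G) = carrier G"
  "le (order_of G) = lgroup_le G"
  "eq (order_of G) = (=)"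
  by (simp_all add: order_of_def)

lemma convex_lsubgroupD:
  assumes "convex_lsubgroup G H"
  shows "subgroup H G"
    and "\<And>x y. \<lbrakk>x \<in> H; y \<in> H\<rbrakk> \<Longrightarrow> x \<squnion>\<^bsub>order_of G\<^esub> y \<in> H"
    and "\<And>x y. \<lbrakk>x \<in> H; y \<in> H\<rbrakk> \<Longrightarrow> x \<sqinter>\<^bsub>order_of G\<^esub> y \<in> H"
    and "\<And>x y z. \<lbrakk>x \<in> H; y \<in> H; z \<in> carrier G; lgroup_le G x z; lgroup_le G z y\<rbrakk> \<Longrightarrow> z \<in> H"
  using assms unfolding convex_lsubgroup_def by blast+

section \<open>Order calculus in a lattice-ordered group\<close>

context lgroup
begin

abbreviation lg_le (infix \<open>\<preceq>\<close> 50) where "x \<preceq> y \<equiv> lgroup_le G x y"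
abbreviation lg_join (infixl \<open>\<curlyvee>\<close> 65) where "x \<curlyvee> y \<equiv> x \<squnion>\<^bsub>order_of G\<^esub> y"
abbreviation lg_meet (infixl \<open>\<curlywedge>\<close> 70) where "x \<curlywedge> y \<equiv> x \<sqinter>\<^bsub>order_of G\<^esub> y"

lemma lg_refl: "x \<in> carrier G \<Longrightarrow> x \<preceq> x"
  using order.le_refl by simp

lemma lg_trans:
  "\<lbrakk>x \<preceq> y; y \<preceq> z; x \<in> carrier G; y \<in> carrier G; z \<in> carrier G\<rbrakk> \<Longrightarrow> x \<preceq> z"
  using order.le_trans by simp

lemma lg_antisym: "\<lbrakk>x \<preceq> y; y \<preceq> x; x \<in> carrier G; y \<in> carrier G\<rbrakk> \<Longrightarrow> x = y"
  using order.weak_le_antisym by simp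

lemma lg_join_closed: "\<lbrakk>x \<in> carrier G; y \<in> carrier G\<rbrakk> \<Longrightarrow> x \<curlyvee> y \<in> carrier G"
  using order.join_closed by simp

lemma lg_meet_closed: "\<lbrakk>x \<in> carrier G; y \<in> carrier G\<rbrakk> \<Longrightarrow> x \<curlywedge> y \<in> carrier G"
  using order.meet_closed by simp

lemma lg_join_upper:
  assumes "x \<in> carrier G" "y \<in> carrier G"
  shows "x \<preceq> x \<curlyvee> y" "y \<preceq> x \<curlyvee> y"
  using assms order.join_left order.join_right by simp_all

lemma lg_meet_lower:
  assumes "x \<in> carrier G" "y \<in> carrier G"
  shows "x \<curlywedge> y \<preceq> x" "x \<curlywedge> y \<preceq> y"
  using assms order.meet_left order.meet_right by simp_all

lemma lg_join_le_iff:
  "\<lbrakk>x \<in> carrier G; y \<in> carrier G; z \<in> carrier G\<rbrakk> \<Longrightarrow> x \<curlyvee> y \<preceq> z \<longleftrightarrow> x \<preceq> z \<and> y \<preceq> z"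
  using order.join_le[of x z y] lg_join_upper[of x y] lg_join_closed[of x y]
    lg_trans[of x "x \<curlyvee> y" z] lg_trans[of y "x \<curlyvee> y" z] by auto

lemma lg_le_meet_iff:
  "\<lbrakk>x \<in> carrier G; y \<in> carrier G; z \<in> carrier G\<rbrakk> \<Longrightarrow> z \<preceq> x \<curlywedge> y \<longleftrightarrow> z \<preceq> x \<and> z \<preceq> y"
  using order.meet_le[of z x y] lg_meet_lower[of x y] lg_meet_closed[of x y]
    lg_trans[of z "x \<curlywedge> y" x] lg_trans[of z "x \<curlywedge> y" y] by auto

lemma lg_join_eqI:
  "\<lbrakk>x \<in> carrier G; y \<in> carrier G; s \<in> carrier G; x \<preceq> s; y \<preceq> s;
    \<And>z. \<lbrakk>z \<in> carrier G; x \<preceq> z; y \<preceq> z\<rbrakk> \<Longrightarrow> s \<preceq> z\<rbrakk> \<Longrightarrow> x \<curlyvee> y = s"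
  by (meson lg_antisym lg_join_closed lg_join_le_iff lg_join_upper)

lemma lg_mult_left_mono:
  "\<lbrakk>x \<preceq> y; x \<in> carrier G; y \<in> carrier G; u \<in> carrier G\<rbrakk> \<Longrightarrow> u \<otimes> x \<preceq> u \<otimes> y"
  using translation_mono[of x y u \<one>] by simp

lemma lg_mult_right_mono:
  "\<lbrakk>x \<preceq> y; x \<in> carrier G; y \<in> carrier G; u \<in> carrier G\<rbrakk> \<Longrightarrow> x \<otimes> u \<preceq> y \<otimes> u"
  using translation_mono[of x y \<one> u] by simp

lemma lg_mult_mono:
  "\<lbrakk>x \<preceq> y; u \<preceq> v; x \<in> carrier G; y \<in> carrier G; u \<in> carrier G; v \<in> carrier G\<rbrakk>
    \<Longrightarrow> x \<otimes> u \<preceq> y \<otimes> v"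
  by (meson lg_mult_left_mono lg_mult_right_mono lg_trans m_closed)

lemma lg_inv_mult_le_iff:
  assumes "x \<in> carrier G" "y \<in> carrier G" "z \<in> carrier G"
  shows "inv x \<otimes> y \<preceq> z \<longleftrightarrow> y \<preceq> x \<otimes> z"
  using assms lg_mult_left_mono[of "inv x \<otimes> y" z x] lg_mult_left_mono[of y "x \<otimes> z" "inv x"]
  by (auto simp: m_assoc[symmetric])

lemma lg_mult_inv_le_iff:
  assumes "x \<in> carrier G" "y \<in> carrier G" "z \<in> carrier G"
  shows "y \<otimes> inv x \<preceq> z \<longleftrightarrow> y \<preceq> z \<otimes> x"
  using assms lg_mult_right_mono[of "y \<otimes> inv x" z x] lg_mult_right_mono[of y "z \<otimes> x" "inv x"]
  by (auto simp: m_assoc)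

lemma lg_inv_le_iff:
  assumes "x \<in> carrier G" "y \<in> carrier G"
  shows "inv x \<preceq> y \<longleftrightarrow> inv y \<preceq> x"
  using assms lg_inv_mult_le_iff[of x \<one> y] lg_mult_inv_le_iff[of y \<one> x] by simp

lemma lg_inv_mono:
  "\<lbrakk>x \<preceq> y; x \<in> carrier G; y \<in> carrier G\<rbrakk> \<Longrightarrow> inv y \<preceq> inv x"
  using lg_inv_le_iff[of y "inv x"] by simp

text \<open>The meet \<open>m\<close> of \<open>p\<close> and \<open>\<one>\<close> turns the
  hypothesis into an inequality that can be cancelled: \<open>inv p \<otimes> m\<close> is below
  \<open>p\<close> because \<open>m \<preceq> p \<otimes> p\<close>, and below \<open>\<one>\<close>
  because \<open>m \<preceq> p\<close>, hence below \<open>m\<close>. The lemma is the source of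
  positivity of absolute values.\<close>

lemma lg_one_le_if_square:
  assumes p: "p \<in> carrier G" and "\<one> \<preceq> p \<otimes> p"
  shows "\<one> \<preceq> p"
proof -
  define m where "m = p \<curlywedge> \<one>"
  have m: "m \<in> carrier G" "m \<preceq> p" "m \<preceq> \<one>"
    using p by (auto simp: m_def lg_meet_lower lg_meet_closed)
  have "m \<preceq> p \<otimes> p"
    using assms m lg_trans m_closed one_closed by blast
  then have "m \<preceq> p \<otimes> m"
    using p m lg_inv_mult_le_iff[of p m p] lg_inv_mult_le_iff[of p m \<one>]
      lg_inv_mult_le_iff[of p m m] lg_le_meet_iff[of p \<one> "inv p \<otimes> m"]
    by (simp add: m_def[symmetric])
  then have "m \<preceq> m \<otimes> m"
    using p m lg_mult_inv_le_iff[of m m p] lg_mult_inv_le_iff[of m m \<one>]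
      lg_mult_inv_le_iff[of m m m] lg_le_meet_iff[of p \<one> "m \<otimes> inv m"] lg_refl
    by (simp add: m_def[symmetric])
  then have "\<one> \<preceq> m"
    using m lg_inv_mult_le_iff[of m m m] by simp
  then show ?thesis
    using m p lg_trans by blast
qed

section \<open>Absolute values and Riesz decomposition\<close>

lemma labs_closed [simp]: "x \<in> carrier G \<Longrightarrow> labs G x \<in> carrier G"
  by (simp add: labs_def lg_join_closed)

lemma labs_le_iff:
  "\<lbrakk>x \<in> carrier G; y \<in> carrier G\<rbrakk> \<Longrightarrow> labs G x \<preceq> y \<longleftrightarrow> x \<preceq> y \<and> inv x \<preceq> y"
  by (simp add: labs_def lg_join_le_iff)

lemma le_labs:
  assumes "x \<in> carrier G"
  shows "x \<preceq> labs G x" "inv x \<preceq> labs G x"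
  using assms by (simp_all add: labs_def lg_join_upper)

text \<open>Multiplying \<open>x \<preceq> labs G x\<close> by
  \<open>inv x \<preceq> labs G x\<close> puts the square of \<open>labs G x\<close> above
  \<open>\<one>\<close>.\<close>

lemma one_le_labs:
  assumes "x \<in> carrier G"
  shows "\<one> \<preceq> labs G x"
  using assms lg_mult_mono[of x "labs G x" "inv x" "labs G x"]
  by (auto intro!: lg_one_le_if_square simp: le_labs)

lemma labs_inv: "x \<in> carrier G \<Longrightarrow> labs G (inv x) = labs G x"
  by (simp add: labs_def join_comm)

lemma labs_of_ge_one:
  assumes "x \<in> carrier G" "\<one> \<preceq> x"
  shows "labs G x = x"
  unfolding labs_def
  using assms lg_inv_mono[of \<one> x] lg_trans[of "inv x" \<one> x]
  by (intro lg_join_eqI) (auto simp: lg_refl)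

lemma lg_le_mult_of_ge_one:
  assumes "x \<in> carrier G" "y \<in> carrier G"
  shows "\<one> \<preceq> y \<Longrightarrow> x \<preceq> x \<otimes> y" "\<one> \<preceq> y \<Longrightarrow> x \<preceq> y \<otimes> x"
  using assms lg_mult_left_mono[of \<one> y x] lg_mult_right_mono[of \<one> y x] by auto

text \<open>
  Without commutativity the triangle inequality needs a third factor on the right.
\<close>

lemma labs_mult_le:
  assumes x: "x \<in> carrier G" and y: "y \<in> carrier G"
  shows "labs G (x \<otimes> y) \<preceq> labs G x \<otimes> (labs G y \<otimes> labs G x)"
proof -
  let ?a = "labs G x" and ?b = "labs G y"
  have c: "?a \<in> carrier G" "?b \<in> carrier G"
    using x y by simp_all
  have "x \<otimes> y \<preceq> ?a \<otimes> ?b"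
    using x y by (intro lg_mult_mono) (auto simp: le_labs)
  moreover have "?a \<otimes> ?b \<preceq> ?a \<otimes> (?b \<otimes> ?a)"
    using c one_le_labs[OF x] by (simp add: lg_le_mult_of_ge_one m_assoc[symmetric])
  moreover have "inv (x \<otimes> y) \<preceq> ?b \<otimes> ?a"
    using x y lg_mult_mono[of "inv y" ?b "inv x" ?a] by (simp add: inv_mult_group le_labs)
  moreover have "?b \<otimes> ?a \<preceq> ?a \<otimes> (?b \<otimes> ?a)"
    using c one_le_labs[OF x] by (simp add: lg_le_mult_of_ge_one)
  ultimately show ?thesis
    using x y c lg_trans[of "x \<otimes> y" "?a \<otimes> ?b" "?a \<otimes> (?b \<otimes> ?a)"]
      lg_trans[of "inv (x \<otimes> y)" "?b \<otimes> ?a" "?a \<otimes> (?b \<otimes> ?a)"]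
    by (simp add: labs_le_iff)
qed

text \<open>The factors are the meet of \<open>y\<close> and \<open>g\<close> and the remaining
  quotient. The bounds by \<open>y\<close> itself are recorded because they keep both factors inside
  any set of positive elements that is closed downwards and contains \<open>y\<close>.\<close>

lemma riesz_decomposition:
  assumes "y \<preceq> g \<otimes> h" "\<one> \<preceq> y" "\<one> \<preceq> g" "\<one> \<preceq> h"
    and c: "y \<in> carrier G" "g \<in> carrier G" "h \<in> carrier G"
  obtains u v where "u \<in> carrier G" "v \<in> carrier G" "y = u \<otimes> v" "\<one> \<preceq> u" "u \<preceq> g" "u \<preceq> y"
    "\<one> \<preceq> v" "v \<preceq> h" "v \<preceq> y"
proof -
  define u where "u = y \<curlywedge> g"
  have u: "u \<in> carrier G" "u \<preceq> y" "u \<preceq> g" "\<one> \<preceq> u"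
    using assms by (auto simp: u_def lg_meet_closed lg_meet_lower lg_le_meet_iff)
  \<comment> \<open>Below \<open>g\<close> by the hypothesis on \<open>y\<close>, and below
    \<open>y\<close> because \<open>h\<close> is positive.\<close>
  have "y \<otimes> inv h \<preceq> u"
    using assms by (simp add: u_def lg_le_meet_iff lg_mult_inv_le_iff lg_le_mult_of_ge_one)
  then have "inv u \<otimes> y \<preceq> h"
    using c u by (simp add: lg_inv_mult_le_iff lg_mult_inv_le_iff)
  moreover have "\<one> \<preceq> inv u \<otimes> y"
    using c u lg_mult_left_mono[of u y "inv u"] by simp
  moreover have "inv u \<otimes> y \<preceq> y"
    using c u by (simp add: lg_inv_mult_le_iff lg_le_mult_of_ge_one)
  ultimately show thesis
    using c u by (intro that[of u "inv u \<otimes> y"]) (auto simp: m_assoc[symmetric])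
qed

section \<open>Convex l-subgroups as solid subgroups\<close>

lemma mem_if_labs_le:
  assumes "convex_lsubgroup G H" "x \<in> H" "z \<in> carrier G" "labs G z \<preceq> labs G x"
  shows "z \<in> H"
proof -
  have sub: "subgroup H G"
    using assms by (simp add: convex_lsubgroupD)
  then have x: "x \<in> carrier G"
    using assms subgroup.mem_carrier by fast
  have ax: "labs G x \<in> H"
    unfolding labs_def using assms(2) subgroup.m_inv_closed[OF sub]
    by (intro convex_lsubgroupD(2)[OF assms(1)]) auto
  have "z \<preceq> labs G x" "inv z \<preceq> labs G x"
    using assms x labs_le_iff[of z "labs G x"] by simp_all
  then have "inv (labs G x) \<preceq> z" "z \<preceq> labs G x"
    using x assms lg_inv_le_iff[of z "labs G x"] by simp_all
  then show ?thesis
    using convex_lsubgroupD(4)[OF assms(1) subgroup.m_inv_closed[OF sub ax] ax assms(3)] by blast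
qed

text \<open>Converse of \<open>mem_if_labs_le\<close>: a solid subgroup is closed under meets, joins
  and intervals, since in each case the element is trapped between \<open>inv w\<close> and
  \<open>w\<close> for one positive \<open>w\<close> in the subgroup. Afterwards convexity can be
  checked through absolute values alone.\<close>

lemma convex_lsubgroupI:
  assumes sub: "subgroup H G"
    and solid: "\<And>x z. \<lbrakk>x \<in> H; z \<in> carrier G; labs G z \<preceq> labs G x\<rbrakk> \<Longrightarrow> z \<in> H"
  shows "convex_lsubgroup G H"
proof -
  have c: "x \<in> carrier G" if "x \<in> H" for x
    using sub that subgroup.mem_carrier by fast
  \<comment> \<open>The disjunctions let one argument cover the join, the meet and any element of an
    interval.\<close>
  have between: "z \<in> H"
    if xy: "x \<in> H" "y \<in> H" and z: "z \<in> carrier G"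
      and up: "z \<preceq> x \<or> z \<preceq> y \<or> (z \<preceq> x \<curlyvee> y)" and lo: "x \<preceq> z \<or> y \<preceq> z \<or> (x \<curlywedge> y \<preceq> z)" for x y z
  proof -
    \<comment> \<open>A product, because the join of the two absolute values is not yet known to lie
      in \<open>H\<close>; positivity of the factors puts it above both.\<close>
    define w where "w = labs G x \<otimes> labs G y"
    have cx: "x \<in> carrier G" "y \<in> carrier G"
      using xy c by auto
    then have ge1: "\<one> \<preceq> labs G x" "\<one> \<preceq> labs G y"
      using one_le_labs by auto
    have abs: "labs G x \<in> H" "labs G y \<in> H"
      using xy cx ge1 solid[of x "labs G x"] solid[of y "labs G y"]
      by (auto simp: labs_of_ge_one lg_refl)
    then have w: "w \<in> H" "w \<in> carrier G"
      using sub subgroup.m_closed c unfolding w_def by fast+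
    have axw: "labs G x \<preceq> w" and ayw: "labs G y \<preceq> w"
      using cx ge1 by (simp_all add: w_def lg_le_mult_of_ge_one)
    then have le: "x \<preceq> w" "inv x \<preceq> w" "y \<preceq> w" "inv y \<preceq> w"
      using cx w by (auto simp: labs_le_iff)
    then have "x \<curlyvee> y \<preceq> w"
      using cx w by (simp add: lg_join_le_iff)
    then have zw: "z \<preceq> w"
      using up le z cx w lg_trans lg_join_closed by meson
    have "inv w \<preceq> x \<curlywedge> y"
      using cx w le by (simp add: lg_le_meet_iff lg_inv_le_iff[of w])
    moreover have "inv w \<preceq> x" "inv w \<preceq> y"
      using cx w le lg_inv_le_iff by auto
    ultimately have "inv w \<preceq> z"
      using lo z cx w lg_trans lg_meet_closed inv_closed by meson
    then have "labs G z \<preceq> w"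
      using zw z w by (simp add: labs_le_iff lg_inv_le_iff[of w])
    moreover have "\<one> \<preceq> w"
      using axw ge1 cx w lg_trans labs_closed one_closed by meson
    ultimately show ?thesis
      using solid[OF w(1) z] w by (simp add: labs_of_ge_one)
  qed
  show ?thesis
    unfolding convex_lsubgroup_def
  proof (intro conjI ballI impI sub)
    fix x y assume xy: "x \<in> H" "y \<in> H"
    show "x \<curlyvee> y \<in> H"
      using xy c by (intro between[OF xy]) (auto simp: lg_join_closed lg_join_upper lg_refl)
    show "x \<curlywedge> y \<in> H"
      using xy c by (intro between[OF xy]) (auto simp: lg_meet_closed lg_meet_lower lg_refl)
  next
    fix x y z assume "x \<in> H" "y \<in> H" "z \<in> carrier G" "x \<preceq> z \<and> z \<preceq> y"
    then show "z \<in> H"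
      using between[of x y z] by blast
  qed
qed

section \<open>Intersections and joins of convex l-subgroups\<close>

lemma convex_lsubgroup_Inter:
  assumes ne: "\<H> \<noteq> {}" and conv: "\<And>H. H \<in> \<H> \<Longrightarrow> convex_lsubgroup G H"
  shows "convex_lsubgroup G (\<Inter>\<H>)"
proof (rule convex_lsubgroupI)
  show "subgroup (\<Inter>\<H>) G"
    using assms by (intro subgroups_Inter) (auto simp: convex_lsubgroupD)
  show "z \<in> \<Inter>\<H>" if "x \<in> \<Inter>\<H>" "z \<in> carrier G" "labs G z \<preceq> labs G x" for x z
    using that conv mem_if_labs_le by blast
qed

lemma convex_lsubgroup_carrier: "convex_lsubgroup G (carrier G)"
  using subgroup_self by (rule convex_lsubgroupI)

text \<open>The join is a choice among least upper bounds, so it says something only once one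
  exists. The intersection of all upper bounds is one; \<open>carrier G\<close> makes this a
  nonempty intersection, also for an empty family.\<close>

lemma least_convex_lsubgroup_Sup:
  assumes "\<And>A. A \<in> \<A> \<Longrightarrow> convex_lsubgroup G A"
  defines "J \<equiv> \<Squnion>\<^bsub>convex_lsubgroup_lattice G\<^esub> \<A>"
  shows "convex_lsubgroup G J" "\<And>A. A \<in> \<A> \<Longrightarrow> A \<subseteq> J"
    "\<And>H. \<lbrakk>convex_lsubgroup G H; \<And>A. A \<in> \<A> \<Longrightarrow> A \<subseteq> H\<rbrakk> \<Longrightarrow> J \<subseteq> H"
proof -
  let ?L = "convex_lsubgroup_lattice G"
  let ?\<H> = "{H. convex_lsubgroup G H \<and> (\<forall>A\<in>\<A>. A \<subseteq> H)}"
  have U: "Upper ?L \<A> = ?\<H>"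
    using assms by (auto simp: Upper_def convex_lsubgroup_lattice_def)
  have "carrier G \<in> ?\<H>"
    using assms convex_lsubgroup_carrier convex_lsubgroupD(1) subgroup.subset by blast
  then have "convex_lsubgroup G (\<Inter>?\<H>)"
    by (intro convex_lsubgroup_Inter) auto
  then have "least ?L (\<Inter>?\<H>) (Upper ?L \<A>)"
    unfolding U by (auto simp: least_def convex_lsubgroup_lattice_def)
  then have "least ?L J (Upper ?L \<A>)"
    unfolding J_def sup_def by (rule someI)
  then show "convex_lsubgroup G J" "\<And>A. A \<in> \<A> \<Longrightarrow> A \<subseteq> J"
    "\<And>H. \<lbrakk>convex_lsubgroup G H; \<And>A. A \<in> \<A> \<Longrightarrow> A \<subseteq> H\<rbrakk> \<Longrightarrow> J \<subseteq> H"
    unfolding U by (auto simp: least_def convex_lsubgroup_lattice_def)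
qed

text \<open>
  This convex \<open>\<ell>\<close>-subgroup serves as an upper bound of the join, so that no description of
  the elements of the join as products is needed.
\<close>

lemma convex_lsubgroup_dominating:
  assumes H: "subgroup H G"
    and Q: "\<And>y. y \<in> Q \<Longrightarrow> y \<in> carrier G \<and> \<one> \<preceq> y"
    and down: "\<And>y u. \<lbrakk>y \<in> Q; u \<in> carrier G; \<one> \<preceq> u; u \<preceq> y\<rbrakk> \<Longrightarrow> u \<in> Q"
  shows "convex_lsubgroup G {g \<in> carrier G. \<forall>y\<in>Q. y \<preceq> labs G g \<longrightarrow> y \<in> H}" (is "convex_lsubgroup G ?P")
proof (rule convex_lsubgroupI)
  show "subgroup ?P G"
  proof (rule subgroupI)
    have "y = \<one>" if "y \<in> Q" "y \<preceq> labs G \<one>" for y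
      using that Q[of y] lg_antisym by (simp add: labs_of_ge_one lg_refl)
    then have "\<one> \<in> ?P"
      using subgroup.one_closed[OF H] by auto
    then show "?P \<noteq> {}"
      by blast
    show "g \<otimes> h \<in> ?P" if "g \<in> ?P" "h \<in> ?P" for g h
    proof (intro CollectI conjI ballI impI)
      have gh: "g \<in> carrier G" "h \<in> carrier G"
        and gQ: "\<And>y. y \<in> Q \<Longrightarrow> y \<preceq> labs G g \<Longrightarrow> y \<in> H"
        and hQ: "\<And>y. y \<in> Q \<Longrightarrow> y \<preceq> labs G h \<Longrightarrow> y \<in> H"
        using that by auto
      let ?g = "labs G g" and ?h = "labs G h"
      have ge1: "\<one> \<preceq> ?g" "\<one> \<preceq> ?h" and cl: "?g \<in> carrier G" "?h \<in> carrier G"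
        using gh one_le_labs by auto
      show "g \<otimes> h \<in> carrier G"
        using gh by simp
      fix y assume y: "y \<in> Q" "y \<preceq> labs G (g \<otimes> h)"
      then have yc: "y \<in> carrier G" "\<one> \<preceq> y"
        using Q by auto
      \<comment> \<open>Two Riesz decompositions split \<open>y\<close> along these three factors.
        Each piece stays in \<open>Q\<close> and is bounded by \<open>?g\<close> or
        \<open>?h\<close>, so it lies in \<open>H\<close>.\<close>
      have "y \<preceq> ?g \<otimes> (?h \<otimes> ?g)"
        using y(2) labs_mult_le[OF gh] gh yc cl lg_trans labs_closed m_closed by meson
      moreover have hg: "\<one> \<preceq> ?h \<otimes> ?g"
        using lg_mult_mono[OF ge1(2) ge1(1)] cl by simp
      ultimately obtain u v where u: "u \<in> carrier G" "\<one> \<preceq> u" "u \<preceq> ?g" "u \<preceq> y"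
        and v: "v \<in> carrier G" "\<one> \<preceq> v" "v \<preceq> ?h \<otimes> ?g" "v \<preceq> y" and yuv: "y = u \<otimes> v"
        using riesz_decomposition[of y ?g "?h \<otimes> ?g"] yc cl ge1 m_closed by blast
      have uQ: "u \<in> Q" and vQ: "v \<in> Q"
        using down y u v by blast+
      obtain s t where s: "s \<in> carrier G" "\<one> \<preceq> s" "s \<preceq> ?h" "s \<preceq> v"
        and t: "t \<in> carrier G" "\<one> \<preceq> t" "t \<preceq> ?g" "t \<preceq> v" and vst: "v = s \<otimes> t"
        using riesz_decomposition[of v ?h ?g] v cl ge1 by blast
      have "s \<in> H" "t \<in> H" "u \<in> H"
        using down[OF vQ] s t u uQ gQ hQ by blast+
      then show "y \<in> H"
        using H subgroup.m_closed unfolding yuv vst by meson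
    qed
  qed (auto simp: labs_inv)
  show "z \<in> ?P" if "x \<in> ?P" "z \<in> carrier G" "labs G z \<preceq> labs G x" for x z
    using that Q lg_trans labs_closed by (intro CollectI conjI ballI impI) blast+
qed

section \<open>Polars\<close>

text \<open>Orthogonality is restated through common positive lower bounds. This removes the meet
  operation, which is computed from a different order once the carrier is restricted.\<close>

lemma polar_iff:
  assumes "S \<subseteq> carrier G"
  shows "h \<in> polar G S \<longleftrightarrow> h \<in> carrier G \<and>
    (\<forall>s\<in>S. \<forall>z\<in>carrier G. \<one> \<preceq> z \<and> z \<preceq> labs G h \<and> z \<preceq> labs G s \<longrightarrow> z = \<one>)"
proof -
  have "labs G h \<curlywedge> labs G s = \<one> \<longleftrightarrow>
    (\<forall>z\<in>carrier G. \<one> \<preceq> z \<and> z \<preceq> labs G h \<and> z \<preceq> labs G s \<longrightarrow> z = \<one>)" (is "?m = \<one> \<longleftrightarrow> ?R")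
    if h: "h \<in> carrier G" and s: "s \<in> carrier G" for s
  proof
    assume "?m = \<one>"
    then show ?R
      using h s lg_le_meet_iff[of "labs G h" "labs G s"] lg_antisym by auto
  next
    assume ?R
    moreover have "\<one> \<preceq> ?m"
      using h s by (simp add: lg_le_meet_iff one_le_labs)
    ultimately show "?m = \<one>"
      using h s by (simp add: lg_meet_lower lg_meet_closed)
  qed
  then show ?thesis
    using assms unfolding polar_def by blast
qed

lemma polar_subset: "polar G S \<subseteq> carrier G"
  by (auto simp: polar_def)

lemma polarD:
  "\<lbrakk>h \<in> polar G S; S \<subseteq> carrier G; s \<in> S; z \<in> carrier G; \<one> \<preceq> z; z \<preceq> labs G h; z \<preceq> labs G s\<rbrakk>
    \<Longrightarrow> z = \<one>"
  by (simp add: polar_iff)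

text \<open>A smaller absolute value has fewer positive lower bounds.\<close>

lemma polar_solid:
  assumes "S \<subseteq> carrier G" "x \<in> polar G S" "z \<in> carrier G" "labs G z \<preceq> labs G x"
  shows "z \<in> polar G S"
  using assms lg_trans[of _ "labs G z" "labs G x"] by (auto simp: polar_iff)

section \<open>Restriction to a convex l-subgroup\<close>

context
  fixes H
  assumes H: "convex_lsubgroup G H"
begin

lemma convex_lsubgroup_subset: "H \<subseteq> carrier G"
  using convex_lsubgroupD(1)[OF H] by (rule subgroup.subset)

text \<open>Joins and meets formed in \<open>G\<close> stay in \<open>H\<close>, so they are still
  least upper and greatest lower bounds there.\<close>

lemma lgroup_convex_lsubgroup: "lgroup (G\<lparr>carrier := H\<rparr>)"
proof -
  let ?K = "G\<lparr>carrier := H\<rparr>"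
  have sub: "subgroup H G"
    using H by (rule convex_lsubgroupD)
  have HG: "x \<in> carrier G" if "x \<in> H" for x
    using that convex_lsubgroup_subset by auto
  have cl: "x \<curlyvee> y \<in> H" "x \<curlywedge> y \<in> H" if "x \<in> H" "y \<in> H" for x y
    using convex_lsubgroupD(2,3)[OF H] that by auto
  have "lattice (order_of ?K)"
  proof unfold_locales
    fix x y assume xy: "x \<in> carrier (order_of ?K)" "y \<in> carrier (order_of ?K)"
    have "least (order_of ?K) (x \<curlyvee> y) (Upper (order_of ?K) {x, y})"
      using xy cl[of x y] HG by (auto simp: least_def Upper_def lg_join_upper lg_join_le_iff)
    then show "\<exists>s. least (order_of ?K) s (Upper (order_of ?K) {x, y})"
      by blast
    have "greatest (order_of ?K) (x \<curlywedge> y) (Lower (order_of ?K) {x, y})"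
      using xy cl[of x y] HG by (auto simp: greatest_def Lower_def lg_meet_lower lg_le_meet_iff)
    then show "\<exists>s. greatest (order_of ?K) s (Lower (order_of ?K) {x, y})"
      by blast
  qed (auto simp: HG lg_refl intro: lg_antisym lg_trans)
  moreover have "group ?K"
    using sub by (rule subgroup_imp_group)
  ultimately show ?thesis
    using translation_mono HG by (auto simp: lgroup_def lgroup_axioms_def)
qed

interpretation K: lgroup "G\<lparr>carrier := H\<rparr>"
  by (rule lgroup_convex_lsubgroup)

lemma labs_convex_lsubgroup:
  assumes "x \<in> H"
  shows "labs (G\<lparr>carrier := H\<rparr>) x = labs G x"
proof -
  have sub: "subgroup H G"
    using H by (rule convex_lsubgroupD)
  have i: "inv\<^bsub>G\<lparr>carrier := H\<rparr>\<^esub> x = inv x"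
    using m_inv_consistent[OF sub assms] by simp
  have ix: "inv x \<in> H"
    using sub assms subgroup.m_inv_closed by fast
  moreover have "x \<curlyvee> inv x \<in> H"
    using assms ix by (rule convex_lsubgroupD(2)[OF H])
  ultimately show ?thesis
    unfolding labs_def i using assms convex_lsubgroup_subset
    by (intro K.lg_join_eqI) (auto simp: lg_join_upper lg_join_le_iff subset_iff)
qed

text \<open>By convexity, every positive lower bound of \<open>labs G x\<close> with
  \<open>x\<close> in \<open>H\<close> lies in \<open>H\<close>, so the test elements of
  \<open>polar_iff\<close> are the same in both groups.\<close>

lemma polar_convex_lsubgroup:
  assumes "S \<subseteq> H"
  shows "polar (G\<lparr>carrier := H\<rparr>) S = polar G S \<inter> H"
proof -
  have S: "S \<subseteq> carrier G"
    using assms convex_lsubgroup_subset by blast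
  have "z \<in> H" if "z \<in> carrier G" "\<one> \<preceq> z" "z \<preceq> labs G x" "x \<in> H" for x z
    using that by (intro mem_if_labs_le[OF H that(4)]) (auto simp: labs_of_ge_one)
  then have *: "(\<forall>s\<in>S. \<forall>z\<in>carrier G. \<one> \<preceq> z \<and> z \<preceq> labs G x \<and> z \<preceq> labs G s \<longrightarrow> z = \<one>) \<longleftrightarrow>
    (\<forall>s\<in>S. \<forall>z\<in>H. \<one> \<preceq> z \<and> z \<preceq> labs G x \<and> z \<preceq> labs G s \<longrightarrow> z = \<one>)" if "x \<in> H" for x
    using that convex_lsubgroup_subset by blast
  show ?thesis
  proof (rule Set.set_eqI)
    fix x
    have "labs (G\<lparr>carrier := H\<rparr>) s = labs G s" if "s \<in> S" for s
      using that assms labs_convex_lsubgroup by blast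
    then show "x \<in> polar (G\<lparr>carrier := H\<rparr>) S \<longleftrightarrow> x \<in> polar G S \<inter> H"
      using assms S convex_lsubgroup_subset *[of x]
      by (cases "x \<in> H") (auto simp: K.polar_iff polar_iff labs_convex_lsubgroup)
  qed
qed

text \<open>Absolute values agree in both groups, and an element dominated in \<open>G\<close> by a
  member of \<open>N \<subseteq> H\<close> already lies in \<open>H\<close>; solidity in
  \<open>H\<close> and in \<open>G\<close> therefore coincide.\<close>

lemma convex_lsubgroup_convex_lsubgroup_iff:
  "convex_lsubgroup (G\<lparr>carrier := H\<rparr>) N \<longleftrightarrow> convex_lsubgroup G N \<and> N \<subseteq> H"
proof
  assume N: "convex_lsubgroup (G\<lparr>carrier := H\<rparr>) N"
  then have sub: "subgroup N (G\<lparr>carrier := H\<rparr>)" "N \<subseteq> H"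
    using convex_lsubgroupD(1) subgroup.subset by fastforce+
  have "convex_lsubgroup G N"
  proof (rule convex_lsubgroupI)
    show "subgroup N G"
      using convex_lsubgroupD(1)[OF H] sub(1) by (rule incl_subgroup)
    fix x z assume xz: "x \<in> N" "z \<in> carrier G" "labs G z \<preceq> labs G x"
    then have "x \<in> H" "z \<in> H"
      using mem_if_labs_le[OF H] sub by blast+
    then show "z \<in> N"
      using xz by (intro K.mem_if_labs_le[OF N xz(1)]) (auto simp: labs_convex_lsubgroup)
  qed
  with sub show "convex_lsubgroup G N \<and> N \<subseteq> H"
    by blast
next
  assume N: "convex_lsubgroup G N \<and> N \<subseteq> H"
  show "convex_lsubgroup (G\<lparr>carrier := H\<rparr>) N"
  proof (rule K.convex_lsubgroupI)
    show "subgroup N (G\<lparr>carrier := H\<rparr>)"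
      using N H by (simp add: subgroup_incl convex_lsubgroupD)
    fix x z assume "x \<in> N" "z \<in> carrier (G\<lparr>carrier := H\<rparr>)"
      "lgroup_le (G\<lparr>carrier := H\<rparr>) (labs (G\<lparr>carrier := H\<rparr>) z) (labs (G\<lparr>carrier := H\<rparr>) x)"
    then show "z \<in> N"
      using N convex_lsubgroup_subset mem_if_labs_le[of N x z]
      by (auto simp: labs_convex_lsubgroup subset_iff)
  qed
qed

text \<open>Restricting to \<open>H\<close> tests \<open>x\<close> against fewer elements orthogonal
  to \<open>a\<close>, but nothing is lost: a positive lower bound of \<open>x\<close> and some
  \<open>b\<close> in the polar of \<open>a\<close> is itself in that polar and in
  \<open>H\<close>.\<close>

lemma bipolar_convex_lsubgroup_subset:
  assumes a: "a \<in> H"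
  shows "polar (G\<lparr>carrier := H\<rparr>) (polar (G\<lparr>carrier := H\<rparr>) {a}) \<subseteq> polar G (polar G {a})"
proof
  fix x assume "x \<in> polar (G\<lparr>carrier := H\<rparr>) (polar (G\<lparr>carrier := H\<rparr>) {a})"
  then have x: "x \<in> polar G (polar G {a} \<inter> H)" "x \<in> H"
    using a polar_convex_lsubgroup[of "{a}"] polar_convex_lsubgroup[of "polar G {a} \<inter> H"] by auto
  have aG: "{a} \<subseteq> carrier G" and xG: "x \<in> carrier G"
    using a x convex_lsubgroup_subset by auto
  have "z = \<one>"
    if b: "b \<in> polar G {a}" and z: "z \<in> carrier G" "\<one> \<preceq> z" "z \<preceq> labs G x" "z \<preceq> labs G b" for b z
  proof -
    have "z \<in> polar G {a}"
      using b z by (intro polar_solid[OF aG b]) (auto simp: labs_of_ge_one)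
    moreover have "z \<in> H"
      using z by (intro mem_if_labs_le[OF H x(2)]) (auto simp: labs_of_ge_one)
    \<comment> \<open>Here \<open>z\<close> is both the element orthogonal to \<open>x\<close> and
      the common lower bound, so it must be \<open>\<one>\<close>.\<close>
    ultimately show ?thesis
      using z convex_lsubgroup_subset
      by (intro polarD[OF x(1), of z]) (auto simp: labs_of_ge_one lg_refl)
  qed
  then show "x \<in> polar G (polar G {a})"
    using xG by (auto simp: polar_iff[OF polar_subset])
qed

end

end

section \<open>Heredity and closure under joins\<close>

lemma semi_boolean_imp_lgroup: "semi_boolean G \<Longrightarrow> lgroup G"
  by (simp add: semi_boolean_def)

text \<open>A convex l-subgroup of \<open>H\<close> is one of \<open>G\<close>, and double polars of
  single elements taken in \<open>H\<close> are contained in those taken in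
  \<open>G\<close>.\<close>

lemma semi_boolean_convex_lsubgroup:
  assumes G: "semi_boolean G" and H: "convex_lsubgroup G H"
  shows "semi_boolean (G\<lparr>carrier := H\<rparr>)"
proof -
  interpret lgroup G
    using G by (rule semi_boolean_imp_lgroup)
  show ?thesis
    using G lgroup_convex_lsubgroup[OF H] bipolar_convex_lsubgroup_subset[OF H]
    unfolding semi_boolean_def convex_lsubgroup_convex_lsubgroup_iff[OF H] by blast
qed

lemma semi_boolean_Sup:
  fixes G :: "'a lgroup" (structure)
  assumes G: "lgroup G"
    and \<A>: "\<And>A. A \<in> \<A> \<Longrightarrow> convex_lsubgroup G A" "\<And>A. A \<in> \<A> \<Longrightarrow> semi_boolean (G\<lparr>carrier := A\<rparr>)"
  shows "semi_boolean (G\<lparr>carrier := \<Squnion>\<^bsub>convex_lsubgroup_lattice G\<^esub> \<A>\<rparr>)"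
proof -
  interpret lgroup G by fact
  define J where "J = \<Squnion>\<^bsub>convex_lsubgroup_lattice G\<^esub> \<A>"
  have J: "convex_lsubgroup G J" and AJ: "\<And>A. A \<in> \<A> \<Longrightarrow> A \<subseteq> J"
    and Jleast: "\<And>H. \<lbrakk>convex_lsubgroup G H; \<And>A. A \<in> \<A> \<Longrightarrow> A \<subseteq> H\<rbrakk> \<Longrightarrow> J \<subseteq> H"
    using least_convex_lsubgroup_Sup[of \<A>] \<A>(1) unfolding J_def by blast+
  have JG: "J \<subseteq> carrier G"
    using convex_lsubgroup_subset[OF J] .
  have "polar (G\<lparr>carrier := J\<rparr>) (polar (G\<lparr>carrier := J\<rparr>) {a}) \<subseteq> N"
    if N: "convex_lsubgroup G N" "N \<subseteq> J" and a: "a \<in> N" for N a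
  proof -
    \<comment> \<open>The double polar of \<open>a\<close> inside the join is
      \<open>B \<inter> J\<close>, but \<open>B\<close> is a polar of the whole group, so
      \<open>polar_solid\<close> applies in \<open>G\<close>.\<close>
    define B where "B = polar G (polar G {a} \<inter> J)"
    have BJ: "polar (G\<lparr>carrier := J\<rparr>) (polar (G\<lparr>carrier := J\<rparr>) {a}) = B \<inter> J"
      using a N polar_convex_lsubgroup[OF J, of "{a}"]
        polar_convex_lsubgroup[OF J, of "polar G {a} \<inter> J"] by (auto simp: B_def)
    have aG: "a \<in> carrier G"
      using a N JG by blast
    have pJ: "polar G {a} \<inter> J \<subseteq> carrier G"
      using JG by blast
    have BG: "B \<subseteq> carrier G"
      unfolding B_def by (rule polar_subset)
    \<comment> \<open>The positive part of \<open>B\<close>; it is closed downwards among positive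
      elements, as \<open>convex_lsubgroup_dominating\<close> requires.\<close>
    define Q where "Q = {y \<in> B. \<one> \<preceq> y}"
    have factor: "y \<in> N" if A: "A \<in> \<A>" and yA: "y \<in> A" and yQ: "y \<in> Q" for A y
    proof -
      have y: "y \<in> carrier G" "\<one> \<preceq> y" "y \<in> B"
        using yQ BG by (auto simp: Q_def)
      note cA = \<A>(1)[OF A]
      define c where "c = labs G a \<curlywedge> y"
      have c: "c \<in> carrier G" "\<one> \<preceq> c" "c \<preceq> y" "c \<preceq> labs G a"
        using y aG by (auto simp: c_def lg_meet_closed lg_meet_lower lg_le_meet_iff one_le_labs)
      have cN: "c \<in> N"
        using c by (intro mem_if_labs_le[OF N(1) a]) (auto simp: labs_of_ge_one)
      have cA': "c \<in> A"
        using c y by (intro mem_if_labs_le[OF cA yA]) (auto simp: labs_of_ge_one)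
      have "z = \<one>"
        if b: "b \<in> polar G {c}" "b \<in> A" and z: "z \<in> carrier G" "\<one> \<preceq> z" "z \<preceq> y" "z \<preceq> labs G b" for b z
      proof -
        \<comment> \<open>Orthogonality of \<open>z\<close> and \<open>a\<close>: a positive
          \<open>w\<close> below both is below \<open>y\<close> and \<open>labs G a\<close>, hence
          below \<open>c\<close>, and also below \<open>labs G b\<close>, while \<open>b\<close> is
          orthogonal to \<open>c\<close>.\<close>
        have "w = \<one>" if w: "w \<in> carrier G" "\<one> \<preceq> w" "w \<preceq> z" "w \<preceq> labs G a" for w
        proof -
          have bG: "b \<in> carrier G"
            using b polar_subset by blast
          have "w \<preceq> y" "w \<preceq> labs G b"
            using w z y bG lg_trans labs_closed by meson+
          then have "w \<preceq> labs G c"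
            using w y aG c by (simp add: labs_of_ge_one) (simp add: c_def lg_le_meet_iff)
          then show ?thesis
            using w \<open>w \<preceq> labs G b\<close> c by (intro polarD[OF b(1), of c]) auto
        qed
        then have "z \<in> polar G {a}"
          using z aG by (auto simp: polar_iff labs_of_ge_one)
        moreover have "z \<in> J"
          using z y by (intro mem_if_labs_le[OF J subsetD[OF AJ[OF A] yA]]) (simp_all add: labs_of_ge_one)
        \<comment> \<open>Membership of \<open>y\<close> in \<open>B\<close> makes it orthogonal to
          \<open>z\<close>, although \<open>z \<preceq> y\<close>.\<close>
        ultimately show ?thesis
          using z y pJ
          by (intro polarD[OF y(3)[unfolded B_def], of z]) (auto simp: labs_of_ge_one lg_refl)
      qed
      then have "y \<in> polar G (polar G {c} \<inter> A)"
        using y polar_iff[of "polar G {c} \<inter> A" y] polar_subset[of "{c}"]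
        by (auto simp: labs_of_ge_one)
      then have "y \<in> polar (G\<lparr>carrier := A\<rparr>) (polar (G\<lparr>carrier := A\<rparr>) {c})"
        using cA' yA polar_convex_lsubgroup[OF cA, of "{c}"]
          polar_convex_lsubgroup[OF cA, of "polar G {c} \<inter> A"] by auto
      moreover have "convex_lsubgroup (G\<lparr>carrier := A\<rparr>) (N \<inter> A)"
        using convex_lsubgroup_Inter[of "{N, A}"] N cA
        by (auto simp: convex_lsubgroup_convex_lsubgroup_iff[OF cA])
      \<comment> \<open>The hypothesis on \<open>A\<close> is applied to its convex l-subgroup
        \<open>N \<inter> A\<close> and the element \<open>c\<close>.\<close>
      ultimately show "y \<in> N"
        using \<A>(2)[OF A] cN cA' unfolding semi_boolean_def by blast
    qed
    let ?P = "{g \<in> carrier G. \<forall>y\<in>Q. y \<preceq> labs G g \<longrightarrow> y \<in> N}"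
    \<comment> \<open>Since \<open>?P\<close> is a convex l-subgroup, it suffices that it contains
      each \<open>A\<close>. There \<open>y \<preceq> labs G x\<close> forces \<open>y\<close> into
      \<open>A\<close>, and \<open>factor\<close> applies.\<close>
    have "J \<subseteq> ?P"
    proof (rule Jleast)
      show "convex_lsubgroup G ?P"
      proof (rule convex_lsubgroup_dominating)
        show "subgroup N G"
          using N by (simp add: convex_lsubgroupD)
        show "y \<in> carrier G \<and> \<one> \<preceq> y" if "y \<in> Q" for y
          using that BG by (auto simp: Q_def)
        show "u \<in> Q" if "y \<in> Q" "u \<in> carrier G" "\<one> \<preceq> u" "u \<preceq> y" for y u
          using that BG polar_solid[OF pJ, of y u] by (auto simp: Q_def B_def labs_of_ge_one)
      qed
      fix A assume A: "A \<in> \<A>"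
      show "A \<subseteq> ?P"
      proof (intro subsetI CollectI conjI ballI impI)
        fix x assume x: "x \<in> A"
        then show "x \<in> carrier G"
          using AJ[OF A] JG by blast
        fix y assume y: "y \<in> Q" "y \<preceq> labs G x"
        then have "y \<in> A"
          using BG by (intro mem_if_labs_le[OF \<A>(1)[OF A] x]) (auto simp: Q_def labs_of_ge_one)
        then show "y \<in> N"
          using factor A y by blast
      qed
    qed
    \<comment> \<open>The condition defining \<open>?P\<close> is used with \<open>labs G x\<close>
      itself as the dominated element of \<open>Q\<close>.\<close>
    moreover have "x \<in> N" if x: "x \<in> B" "x \<in> ?P" for x
    proof -
      have xG: "x \<in> carrier G"
        using x BG by blast
      then have abs: "labs G (labs G x) = labs G x"
        by (simp add: labs_of_ge_one one_le_labs)
      then have "labs G x \<in> B"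
        using x xG polar_solid[OF pJ, of x "labs G x"] by (simp add: B_def lg_refl)
      then have "labs G x \<in> N"
        using x xG by (simp add: Q_def one_le_labs lg_refl)
      then show ?thesis
        by (rule mem_if_labs_le[OF N(1) _ xG]) (simp add: abs xG lg_refl)
    qed
    ultimately show ?thesis
      unfolding BJ by blast
  qed
  then show ?thesis
    using lgroup_convex_lsubgroup[OF J]
    unfolding semi_boolean_def J_def[symmetric] convex_lsubgroup_convex_lsubgroup_iff[OF J] by blast
qed

section \<open>Invariance under isomorphism\<close>

context
  fixes G :: "'a lgroup" and K :: "'b lgroup" and f
  assumes G: "lgroup G" and K: "lgroup K" and f: "f \<in> lgroup_iso G K"
begin

interpretation G: lgroup G by (rule G)
interpretation K: lgroup K by (rule K)

lemma lgroup_iso_simps: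
  shows "f \<in> hom G K" and "inj_on f (carrier G)" and "f ` carrier G = carrier K"
    and "\<And>x. x \<in> carrier G \<Longrightarrow> f x \<in> carrier K"
    and "\<And>x y. \<lbrakk>x \<in> carrier G; y \<in> carrier G\<rbrakk> \<Longrightarrow> f (x \<otimes>\<^bsub>G\<^esub> y) = f x \<otimes>\<^bsub>K\<^esub> f y"
    and "\<And>x y. \<lbrakk>x \<in> carrier G; y \<in> carrier G\<rbrakk> \<Longrightarrow>
      f (x \<squnion>\<^bsub>order_of G\<^esub> y) = f x \<squnion>\<^bsub>order_of K\<^esub> f y"
    and "\<And>x y. \<lbrakk>x \<in> carrier G; y \<in> carrier G\<rbrakk> \<Longrightarrow>
      f (x \<sqinter>\<^bsub>order_of G\<^esub> y) = f x \<sqinter>\<^bsub>order_of K\<^esub> f y"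
  using f by (auto simp: lgroup_iso_def iso_def bij_betw_def join_pres_def meet_pres_def hom_def)

interpretation f: group_hom G K f
  by unfold_locales (rule lgroup_iso_simps)

text \<open>The order is recovered from preserved joins: \<open>x \<preceq> y\<close> makes
  \<open>y\<close> the join of \<open>x\<close> and \<open>y\<close>.\<close>

lemma lgroup_iso_mono:
  "\<lbrakk>x \<in> carrier G; y \<in> carrier G; lgroup_le G x y\<rbrakk> \<Longrightarrow> lgroup_le K (f x) (f y)"
  using G.lg_join_eqI[of x y y] lgroup_iso_simps(6)[of x y] K.lg_join_upper(1)[of "f x" "f y"]
  by (simp add: G.lg_refl)

lemma lgroup_iso_labs: "x \<in> carrier G \<Longrightarrow> f (labs G x) = labs K (f x)"
  by (simp add: labs_def lgroup_iso_simps)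

text \<open>Injectivity reflects the equation of a meet with \<open>\<one>\<close>, and surjectivity
  makes every candidate in \<open>K\<close> an image.\<close>

lemma lgroup_iso_polar:
  assumes S: "S \<subseteq> carrier G"
  shows "polar K (f ` S) = f ` polar G S"
proof -
  have "labs K (f h) \<sqinter>\<^bsub>order_of K\<^esub> labs K (f s) = \<one>\<^bsub>K\<^esub> \<longleftrightarrow>
      labs G h \<sqinter>\<^bsub>order_of G\<^esub> labs G s = \<one>\<^bsub>G\<^esub>"
    if "h \<in> carrier G" "s \<in> carrier G" for h s
    using that inj_onD[OF lgroup_iso_simps(2), of "labs G h \<sqinter>\<^bsub>order_of G\<^esub> labs G s" "\<one>\<^bsub>G\<^esub>"]
    by (auto simp: lgroup_iso_labs[symmetric] lgroup_iso_simps(7)[symmetric] G.lg_meet_closed)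
  then show ?thesis
    using S unfolding polar_def lgroup_iso_simps(3)[symmetric] by (auto simp: subset_iff)
qed

lemma convex_lsubgroup_lgroup_iso_vimage:
  assumes H: "convex_lsubgroup K H"
  shows "convex_lsubgroup G {x \<in> carrier G. f x \<in> H}"
proof (rule G.convex_lsubgroupI)
  have sub: "subgroup H K"
    using H by (rule convex_lsubgroupD)
  show "subgroup {x \<in> carrier G. f x \<in> H} G"
    by (rule G.subgroupI)
      (auto simp: subgroup.m_inv_closed[OF sub] subgroup.m_closed[OF sub]
        intro!: exI[of _ "\<one>\<^bsub>G\<^esub>"] subgroup.one_closed[OF sub])
  show "z \<in> {x \<in> carrier G. f x \<in> H}"
    if "x \<in> {x \<in> carrier G. f x \<in> H}" "z \<in> carrier G" "lgroup_le G (labs G z) (labs G x)" for x z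
    using that lgroup_iso_mono[of "labs G z" "labs G x"] K.mem_if_labs_le[OF H, of "f x" "f z"]
    by (auto simp: lgroup_iso_labs)
qed

text \<open>A convex l-subgroup of \<open>K\<close> is pulled back to \<open>G\<close>, where the
  hypothesis applies, and the resulting double polar is pushed forward again.\<close>

lemma semi_boolean_lgroup_iso:
  assumes sb: "semi_boolean G"
  shows "semi_boolean K"
  unfolding semi_boolean_def
proof (intro conjI K allI impI ballI)
  fix H b assume H: "convex_lsubgroup K H" and b: "b \<in> H"
  then have "b \<in> f ` carrier G"
    using K.convex_lsubgroup_subset[OF H] by (auto simp: lgroup_iso_simps(3))
  then obtain a where a: "a \<in> carrier G" "f a \<in> H" "b = f a"
    using b by blast
  have "f ` polar G (polar G {a}) \<subseteq> H"
    using sb convex_lsubgroup_lgroup_iso_vimage[OF H] a unfolding semi_boolean_def by blast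
  moreover have "polar K (polar K {b}) = f ` polar G (polar G {a})"
    using lgroup_iso_polar[of "{a}"] lgroup_iso_polar[OF G.polar_subset[of "{a}"]] a by simp
  ultimately show "polar K (polar K {b}) \<subseteq> H"
    by simp
qed

end

lemma closed_under_iso_semi_boolean:
  "closed_under_iso (semi_boolean :: 'a lgroup \<Rightarrow> bool) (semi_boolean :: 'b lgroup \<Rightarrow> bool)"
  unfolding closed_under_iso_def
  using semi_boolean_lgroup_iso semi_boolean_imp_lgroup by blast

section \<open>Nonemptiness and the final assembly\<close>

text \<open>A one-element group can be placed on any type, which makes the class nonempty at every
  type.\<close>

lemma semi_boolean_trivial:
  fixes e :: 'a
  defines "T \<equiv> \<lparr>carrier = {e}, monoid.mult = \<lambda>_ _. e, one = e, lgroup_le = \<lambda>_ _. True\<rparr>"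
  shows "semi_boolean T"
proof -
  have "group T"
    by (rule groupI) (auto simp: T_def)
  moreover have "lattice (order_of T)"
    by unfold_locales (auto simp: T_def least_def greatest_def Upper_def Lower_def)
  ultimately have "lgroup T"
    by (auto simp: lgroup_def lgroup_axioms_def T_def)
  moreover have "polar T S \<subseteq> H" if "convex_lsubgroup T H" for S H
    using subgroup.one_closed[OF convex_lsubgroupD(1)[OF that]] by (auto simp: polar_def T_def)
  ultimately show ?thesis
    by (simp add: semi_boolean_def)
qed

theorem theorem4p9:
  shows "radical_class (semi_boolean :: 'a lgroup \<Rightarrow> bool)
       \<and> closed_under_iso (semi_boolean :: 'a lgroup \<Rightarrow> bool) (semi_boolean :: 'b lgroup \<Rightarrow> bool)"
  unfolding radical_class_def
proof (intro conjI allI impI closed_under_iso_semi_boolean)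
  show "\<exists>G :: 'a lgroup. semi_boolean G"
    by (rule exI) (rule semi_boolean_trivial)
qed (use semi_boolean_imp_lgroup semi_boolean_convex_lsubgroup semi_boolean_Sup in blast)+

end
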